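(* Let $G$ be an abelian group, $\mathcal{D}\cong M_n(\mathbb{C})$, and $\Gamma$ a division $G$-grading on $\mathcal{D}$ as a complex algebra, with support $T$ and $\mathcal{D}_e=Z(\mathcal{D})=\mathbb{C}$. Let $\varphi$ be a distinguished involution of the graded algebra $\mathcal{D}$ (see context). Put $T^{[2]}=\{t^2:t\in T\}$ and $\mathcal{D}^{[2]}=\bigoplus_{s\in T^{[2]}}\mathcal{D}_s$. Then there exists a unique basis $\{X_s\mid s\in T^{[2]}\}$ of the complex algebra $\mathcal{D}^{[2]}$, with $X_s\in\mathcal{D}_s$, having the following properties for every $s\in T^{[2]}$: $\varphi(X_s)=X_s$; $X_s^{o(s)}=1$, where $o(s)$ is the order of $s$; and, for any $t\in T$ with $t^2=s$ and any nonzero $X\in\mathcal{D}_t$, $\varphi(X)=X$ implies $X^2\in\mathbb{R}_{>0}X_s$.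
   Context: A division $G$-grading on $\mathcal{D}$ is a decomposition $\mathcal{D}=\bigoplus_{g\in G}\mathcal{D}_g$ with $\mathcal{D}_g\mathcal{D}_h\subseteq\mathcal{D}_{gh}$ in which every nonzero homogeneous element is invertible; here the components are complex subspaces and the nonzero ones have complex dimension $1$. An involution $\varphi$ of the graded algebra is of the second kind if $\varphi(iI)=-iI$. A second kind involution $\varphi$ with $\varphi(\mathcal{D}_g)=\mathcal{D}_g$ for all $g$ is called distinguished if it satisfies any of the following equivalent conditions: its signature is nonzero; its signature is $\sqrt{|\{t\in T:t^2=e\}|}$; for any $t\in T$ of even order $o(t)$ and nonzero $X\in\mathcal{D}_t$, $\varphi(X)=X$ implies $X^{o(t)}\in\mathbb{R}_{>0}$. (The signature is $|m_+-m_-|$ for a diagonalization of a hermitian form to which $\varphi$ is adjoint.) *)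

theory Defs
  imports "HOL-Analysis.Analysis" "HOL-Algebra.Multiplicative_Group"
begin

section \<open>Complex algebras\<close>

locale complex_algebra = vector_space smul
  for smul :: "complex \<Rightarrow> 'd::ring_1 \<Rightarrow> 'd" +
  assumes smul_mult_left: "smul c x * y = smul c (x * y)"
    and smul_mult_right: "x * smul c y = smul c (x * y)"

definition center :: "'d::ring_1 set" where
  "center = {x. \<forall>y. x * y = y * x}"

text \<open>The product on the type of square matrices is \<open>**\<close>; the type-class product \<open>*\<close> would be
  the entrywise one.  Multiplication by \<open>mat c\<close> is the scalar action of \<open>c\<close> on matrices.\<close>

definition matrix_algebra_iso ::
  "(complex \<Rightarrow> 'd::ring_1 \<Rightarrow> 'd) \<Rightarrow> ('d \<Rightarrow> complex^'n^'n) \<Rightarrow> bool" where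
  "matrix_algebra_iso smul \<Psi> \<longleftrightarrow>
     bij \<Psi> \<and>
     (\<forall>x y. \<Psi> (x + y) = \<Psi> x + \<Psi> y) \<and>
     (\<forall>c x. \<Psi> (smul c x) = mat c ** \<Psi> x) \<and>
     (\<forall>x y. \<Psi> (x * y) = \<Psi> x ** \<Psi> y) \<and>
     \<Psi> 1 = mat 1"

definition positive_multiples :: "(complex \<Rightarrow> 'd \<Rightarrow> 'd) \<Rightarrow> 'd \<Rightarrow> 'd set" where
  "positive_multiples smul y = {smul (complex_of_real r) y |r. r > 0}"

section \<open>Gradings\<close>

definition direct_sum_decomposition :: "'i set \<Rightarrow> ('i \<Rightarrow> 'd::ab_group_add set) \<Rightarrow> bool" where
  "direct_sum_decomposition I V \<longleftrightarrow>
     (\<forall>x. \<exists>!c. (\<forall>i\<in>I. c i \<in> V i) \<and> (\<forall>i. i \<notin> I \<longrightarrow> c i = 0) \<and>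
               finite {i. c i \<noteq> 0} \<and> x = (\<Sum>i | c i \<noteq> 0. c i))"

definition grading ::
  "('g, 'b) monoid_scheme \<Rightarrow> (complex \<Rightarrow> 'd::ring_1 \<Rightarrow> 'd) \<Rightarrow> ('g \<Rightarrow> 'd set) \<Rightarrow> bool" where
  "grading G smul D \<longleftrightarrow>
     (\<forall>g\<in>carrier G. module.subspace smul (D g)) \<and>
     direct_sum_decomposition (carrier G) D \<and>
     (\<forall>g\<in>carrier G. \<forall>h\<in>carrier G. \<forall>x\<in>D g. \<forall>y\<in>D h. x * y \<in> D (g \<otimes>\<^bsub>G\<^esub> h))"

text \<open>Division gradings whose nonzero components are one-dimensional over the complex numbers.\<close>

definition division_grading ::
  "('g, 'b) monoid_scheme \<Rightarrow> (complex \<Rightarrow> 'd::ring_1 \<Rightarrow> 'd) \<Rightarrow> ('g \<Rightarrow> 'd set) \<Rightarrow> bool" where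
  "division_grading G smul D \<longleftrightarrow>
     grading G smul D \<and>
     (\<forall>g\<in>carrier G. \<forall>x\<in>D g. x \<noteq> 0 \<longrightarrow> (\<exists>y. x * y = 1 \<and> y * x = 1)) \<and>
     (\<forall>g\<in>carrier G. D g \<noteq> {0} \<longrightarrow> vector_space.dim smul (D g) = 1)"

definition grading_support :: "('g, 'b) monoid_scheme \<Rightarrow> ('g \<Rightarrow> 'd::zero set) \<Rightarrow> 'g set" where
  "grading_support G D = {g \<in> carrier G. D g \<noteq> {0}}"

definition squares :: "('g, 'b) monoid_scheme \<Rightarrow> 'g set \<Rightarrow> 'g set" where
  "squares G T = {t \<otimes>\<^bsub>G\<^esub> t |t. t \<in> T}"

text \<open>The sum of the components with index in \<open>S\<close>.  Inside a grading this sum is direct.\<close>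

definition component_sum ::
  "(complex \<Rightarrow> 'd::ring_1 \<Rightarrow> 'd) \<Rightarrow> ('g \<Rightarrow> 'd set) \<Rightarrow> 'g set \<Rightarrow> 'd set" where
  "component_sum smul D S = module.span smul (\<Union>s\<in>S. D s)"

definition indexed_basis ::
  "(complex \<Rightarrow> 'd::ring_1 \<Rightarrow> 'd) \<Rightarrow> 'd set \<Rightarrow> 'i set \<Rightarrow> ('i \<Rightarrow> 'd) \<Rightarrow> bool" where
  "indexed_basis smul V I X \<longleftrightarrow>
     inj_on X I \<and> \<not> module.dependent smul (X ` I) \<and> module.span smul (X ` I) = V"

section \<open>Involutions and their signature\<close>

text \<open>Involutions are taken over the reals: one of the second kind is conjugate-linear.\<close>

definition involution :: "(complex \<Rightarrow> 'd::ring_1 \<Rightarrow> 'd) \<Rightarrow> ('d \<Rightarrow> 'd) \<Rightarrow> bool" where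
  "involution smul \<phi> \<longleftrightarrow>
     (\<forall>x y. \<phi> (x + y) = \<phi> x + \<phi> y) \<and>
     (\<forall>r x. \<phi> (smul (complex_of_real r) x) = smul (complex_of_real r) (\<phi> x)) \<and>
     (\<forall>x y. \<phi> (x * y) = \<phi> y * \<phi> x) \<and>
     (\<forall>x. \<phi> (\<phi> x) = x)"

definition second_kind_involution :: "(complex \<Rightarrow> 'd::ring_1 \<Rightarrow> 'd) \<Rightarrow> ('d \<Rightarrow> 'd) \<Rightarrow> bool" where
  "second_kind_involution smul \<phi> \<longleftrightarrow>
     involution smul \<phi> \<and> \<phi> (smul \<i> 1) = - smul \<i> 1"

definition hermitian_form :: "(complex^'n \<Rightarrow> complex^'n \<Rightarrow> complex) \<Rightarrow> bool" where
  "hermitian_form h \<longleftrightarrow>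
     (\<forall>u v w. h u (v + w) = h u v + h u w) \<and>
     (\<forall>c u v. h u (c *s v) = c * h u v) \<and>
     (\<forall>u v. h v u = cnj (h u v))"

definition nondegenerate :: "(complex^'n \<Rightarrow> complex^'n \<Rightarrow> complex) \<Rightarrow> bool" where
  "nondegenerate h \<longleftrightarrow> (\<forall>u. (\<forall>v. h u v = 0) \<longrightarrow> u = 0)"

definition adjoint_to ::
  "('d \<Rightarrow> complex^'n^'n) \<Rightarrow> ('d \<Rightarrow> 'd) \<Rightarrow> (complex^'n \<Rightarrow> complex^'n \<Rightarrow> complex) \<Rightarrow> bool" where
  "adjoint_to \<Psi> \<phi> h \<longleftrightarrow> (\<forall>x u v. h (\<Psi> x *v u) v = h u (\<Psi> (\<phi> x) *v v))"

definition diagonalizing_basis ::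
  "(complex^'n \<Rightarrow> complex^'n \<Rightarrow> complex) \<Rightarrow> ('n \<Rightarrow> complex^'n) \<Rightarrow> bool" where
  "diagonalizing_basis h b \<longleftrightarrow>
     inj b \<and> vec.independent (range b) \<and> vec.span (range b) = UNIV \<and>
     (\<forall>i j. i \<noteq> j \<longrightarrow> h (b i) (b j) = 0)"

text \<open>The form to which \<open>\<phi>\<close> is adjoint is determined up to a nonzero real factor, which may
  exchange the numbers of positive and negative diagonal entries; with the law of inertia this
  makes the value \<open>k\<close> below unique.  The diagonal entries \<open>h (b i) (b i)\<close> are real.\<close>

definition has_signature ::
  "('d \<Rightarrow> complex^'n^'n) \<Rightarrow> ('d \<Rightarrow> 'd) \<Rightarrow> nat \<Rightarrow> bool" where
  "has_signature \<Psi> \<phi> k \<longleftrightarrow>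
     (\<exists>h b. hermitian_form h \<and> nondegenerate h \<and> adjoint_to \<Psi> \<phi> h \<and> diagonalizing_basis h b \<and>
        k = nat \<bar>int (card {i. Re (h (b i) (b i)) > 0}) - int (card {i. Re (h (b i) (b i)) < 0})\<bar>)"

text \<open>The last three clauses are equivalent for a second kind involution that preserves the
  components of a division grading as above, and each of them is used as the definition of a
  distinguished involution; their disjunction lets any one of them suffice.\<close>

definition distinguished_involution ::
  "('g, 'b) monoid_scheme \<Rightarrow> (complex \<Rightarrow> 'd::ring_1 \<Rightarrow> 'd) \<Rightarrow> ('d \<Rightarrow> complex^'n^'n) \<Rightarrow>
   ('g \<Rightarrow> 'd set) \<Rightarrow> ('d \<Rightarrow> 'd) \<Rightarrow> bool" where
  "distinguished_involution G smul \<Psi> D \<phi> \<longleftrightarrow>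
     second_kind_involution smul \<phi> \<and>
     (\<forall>g\<in>carrier G. \<phi> ` D g = D g) \<and>
     ((\<exists>k. has_signature \<Psi> \<phi> k \<and> k \<noteq> 0) \<or>
      (\<exists>k. has_signature \<Psi> \<phi> k \<and>
           real k = sqrt (real (card {t \<in> grading_support G D. t \<otimes>\<^bsub>G\<^esub> t = \<one>\<^bsub>G\<^esub>}))) \<or>
      (\<forall>t\<in>grading_support G D. even (group.ord G t) \<longrightarrow>
           (\<forall>x\<in>D t. x \<noteq> 0 \<longrightarrow> \<phi> x = x \<longrightarrow> x ^ group.ord G t \<in> positive_multiples smul 1)))"

end

theory Submission
  imports Defs
begin

text \<open>For \<open>t \<in> T\<close> with \<open>t\<^sup>2 = s\<close>, the component \<open>D t\<close> contains a symmetric element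
  \<open>x \<noteq> 0\<close>, unique up to a real factor, so the ray of positive multiples of \<open>x\<^sup>2\<close> in \<open>D s\<close>
  depends only on \<open>t\<close>.  The properties required of \<open>X s\<close> say that it lies on the rays of all square
  roots \<open>t\<close> of \<open>s\<close> and that \<open>X s ^ o(s) = 1\<close>.  Hence everything rests on two points: the ray must be
  the same for all square roots of \<open>s\<close>, and it must contain an element whose power with exponent
  \<open>o(s)\<close> is \<open>1\<close>.  That element is then unique, because a positive real with a positive power equal to \<open>1\<close> is \<open>1\<close>;
  and the resulting family is a basis because the components are lines.  The orders involved are positive
  because \<open>T\<close> is finite, homogeneous elements of distinct degrees being linearly independent.

  Both points follow from the condition that symmetric \<open>x \<in> D t\<close> have \<open>x ^ o(t) > 0\<close> when \<open>o(t)\<close> is even.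
  For the power, \<open>(x\<^sup>2) ^ o(t\<^sup>2)\<close> is \<open>x ^ o(t)\<close> if \<open>o(t)\<close> is even and the square of the nonzero real
  \<open>x ^ o(t)\<close> otherwise (\<open>square_positive_power\<close>).  For the ray, two square roots of \<open>s\<close>
  differ by some \<open>a\<close> with \<open>a\<^sup>2 = e\<close>, and a symmetric \<open>y \<in> D a\<close> has \<open>y\<^sup>2 > 0\<close>.  As \<open>x\<close> and \<open>y\<close>
  commute or anticommute, \<open>x * y\<close> or \<open>\<i> * x * y\<close> is symmetric; in both cases its square is
  \<open>x\<^sup>2 * y\<^sup>2\<close>, a positive multiple of \<open>x\<^sup>2\<close> (\<open>square_unique_up_to_positive\<close>).

  An involution may also be distinguished through its signature, which is then nonzero.  In that case
  the positivity condition holds (\<open>nonzero_signature_imp_positive_power\<close>): were \<open>x ^ o(t)\<close> negative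
  with \<open>o(t) = 2 * m\<close>, the selfadjoint operator \<open>x ^ m\<close> would carry the hermitian form to a negative
  multiple of itself, and the signature would be zero (\<open>anti_isometry_card_eq\<close>).\<close>

section \<open>Hermitian forms admitting an anti-isometry\<close>

lemma hermitian_formD:
  assumes "hermitian_form h"
  shows "h u (v + w) = h u v + h u w" "h u (c *s v) = c * h u v" "h v u = cnj (h u v)"
  using assms unfolding hermitian_form_def by blast+

lemma hermitian_form_sum_right:
  assumes "hermitian_form h"
  shows "h u (\<Sum>i\<in>P. a i *s b i) = (\<Sum>i\<in>P. a i * h u (b i))"
proof -
  have "h u 0 = 0" using hermitian_formD(2)[OF assms, of u 0 0] by simp
  then show ?thesis
    by (induction P rule: infinite_finite_induct) (simp_all add: hermitian_formD(1,2)[OF assms])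
qed

lemma hermitian_form_sum_left:
  assumes "hermitian_form h"
  shows "h (\<Sum>i\<in>P. a i *s b i) v = (\<Sum>i\<in>P. cnj (a i) * h (b i) v)"
proof -
  have "h (\<Sum>i\<in>P. a i *s b i) v = cnj (h v (\<Sum>i\<in>P. a i *s b i))"
    by (rule hermitian_formD(3)[OF assms])
  then show ?thesis
    by (simp add: hermitian_form_sum_right[OF assms] flip: hermitian_formD(3)[OF assms])
qed

lemma hermitian_form_orthogonal_sum:
  fixes b :: "'n \<Rightarrow> complex^'n"
  assumes h: "hermitian_form h" and orth: "\<forall>i j. i \<noteq> j \<longrightarrow> h (b i) (b j) = 0"
  shows "Re (h (\<Sum>i\<in>P. a i *s b i) (\<Sum>i\<in>P. a i *s b i)) = (\<Sum>i\<in>P. (cmod (a i))\<^sup>2 * Re (h (b i) (b i)))"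
proof -
  have "h (\<Sum>i\<in>P. a i *s b i) (\<Sum>i\<in>P. a i *s b i)
      = (\<Sum>i\<in>P. \<Sum>j\<in>P. cnj (a i) * (a j * h (b i) (b j)))"
    by (simp only: hermitian_form_sum_left[OF h])
      (simp only: hermitian_form_sum_right[OF h] sum_distrib_left)
  also have "\<dots> = (\<Sum>i\<in>P. \<Sum>j\<in>P. if j = i then cnj (a i) * (a i * h (b i) (b i)) else 0)"
    by (intro sum.cong) (auto simp: orth)
  also have "\<dots> = (\<Sum>i\<in>P. (a i * cnj (a i)) * h (b i) (b i))"
    by (simp add: mult_ac)
  also have "\<dots> = (\<Sum>i\<in>P. of_real ((cmod (a i))\<^sup>2) * h (b i) (b i))"
    by (simp only: complex_norm_square)
  finally show ?thesis by simp
qed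

lemma in_span_family:
  fixes b :: "'n \<Rightarrow> complex^'n"
  assumes "inj b" "u \<in> vec.span (b ` P)"
  obtains a where "u = (\<Sum>i\<in>P. a i *s b i)"
proof -
  obtain f where "u = (\<Sum>v\<in>b ` P. f v *s v)"
    using assms(2) vec.span_finite[of "b ` P"] by auto
  also have "\<dots> = (\<Sum>i\<in>P. f (b i) *s b i)"
    using assms(1) by (subst sum.reindex) (auto intro: inj_on_subset simp: o_def)
  finally show ?thesis by (rule that)
qed

text \<open>The map \<open>S\<close> carries the span of the vectors of positive length, on which it is injective, to a
  subspace on which \<open>h\<close> is negative definite.  That image meets the span of the vectors of nonnegative
  length only in \<open>0\<close>, so the dimensions of the two add up to at most that of the whole space.\<close>

lemma anti_isometry_card_le:
  fixes b :: "'n \<Rightarrow> complex^'n" and S :: "complex^'n^'n"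
  assumes h: "hermitian_form h" and b: "diagonalizing_basis h b"
    and S: "\<And>u. h (S *v u) (S *v u) = - (complex_of_real c) * h u u" and c: "c > 0"
  shows "card {i. Re (h (b i) (b i)) > 0} \<le> card {i. Re (h (b i) (b i)) < 0}"
proof (rule ccontr)
  let ?P = "{i. Re (h (b i) (b i)) > 0}" and ?N = "{i. Re (h (b i) (b i)) < 0}"
  let ?A = "vec.span (b ` ?P)" and ?B = "vec.span (b ` (- ?N))"
  assume "\<not> card ?P \<le> card ?N"
  have inj: "inj b" and ind: "vec.independent (range b)"
    and orth: "\<forall>i j. i \<noteq> j \<longrightarrow> h (b i) (b j) = 0"
    using b by (auto simp: diagonalizing_basis_def)
  have dim: "vec.dim (vec.span (b ` Q)) = card Q" for Q
    using vec.independent_mono[OF ind, of "b ` Q"] inj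
    by (simp add: vec.dim_span_eq_card_independent card_image inj_on_subset image_mono del: vec.dim_span)
  have pos: "Re (h u u) > 0" if u: "u \<in> ?A" "u \<noteq> 0" for u
  proof -
    obtain a where a: "u = (\<Sum>i\<in>?P. a i *s b i)"
      using in_span_family[OF inj u(1)] by blast
    then obtain i where "i \<in> ?P" "a i \<noteq> 0"
      using u(2) by (metis (no_types, lifting) sum.neutral vec.scale_eq_0_iff)
    then show ?thesis
      unfolding a hermitian_form_orthogonal_sum[OF h orth]
      by (intro sum_pos2[of _ i]) auto
  qed
  have nonneg: "Re (h u u) \<ge> 0" if u: "u \<in> ?B" for u
  proof -
    obtain a where a: "u = (\<Sum>i\<in>-?N. a i *s b i)"
      using in_span_family[OF inj u] by blast
    show ?thesis
      unfolding a hermitian_form_orthogonal_sum[OF h orth]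
      by (intro sum_nonneg) auto
  qed
  have ReS: "Re (h (S *v u) (S *v u)) = - c * Re (h u u)" for u
    by (simp add: S)
  have neg: "Re (h (S *v u) (S *v u)) < 0" if "u \<in> ?A" "u \<noteq> 0" for u
    using pos[OF that] c by (simp add: ReS)
  have h0: "h 0 0 = 0"
    using hermitian_formD(2)[OF h, of 0 0 0] by simp
  have "inj_on ((*v) S) ?A"
    by (subst vec.inj_on_iff_eq_0) (use neg h0 in force)+
  then have dimS: "vec.dim ((*v) S ` ?A) = card ?P"
    using vec.dim_image_eq[of "(*v) S" ?A] dim
    by (simp add: vec.linear_axioms vec.span_span del: vec.dim_span)
  have "vec.dim ((*v) S ` ?A \<inter> ?B) > 0"
  proof -
    have "vec.dim {x + y |x y. x \<in> (*v) S ` ?A \<and> y \<in> ?B} + vec.dim ((*v) S ` ?A \<inter> ?B)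
        = card ?P + card (- ?N)"
      by (subst vec.dim_sums_Int) (auto simp: dimS dim vec.subspace_image simp del: vec.dim_span)
    moreover have "vec.dim {x + y |x y. x \<in> (*v) S ` ?A \<and> y \<in> ?B} \<le> CARD('n)"
      by (rule dim_subset_UNIV_cart_gen)
    moreover have "card (?N \<union> - ?N) = card ?N + card (- ?N)"
      by (rule card_Un_disjoint) auto
    then have "CARD('n) = card ?N + card (- ?N)"
      by (simp only: Compl_partition)
    ultimately show ?thesis using \<open>\<not> card ?P \<le> card ?N\<close> by linarith
  qed
  then have "\<not> (*v) S ` ?A \<inter> ?B \<subseteq> {0}"
    by (simp only: vec.dim_eq_0[symmetric] neq0_conv)
  then obtain u where "u \<in> ?A" "S *v u \<in> ?B" "S *v u \<noteq> 0"
    by blast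
  moreover from this have "u \<noteq> 0" by auto
  ultimately show False
    using neg[of u] nonneg[of "S *v u"] by linarith
qed

text \<open>The form \<open>- h\<close> satisfies the same hypotheses as \<open>h\<close>, with the two counts exchanged.\<close>

lemma anti_isometry_card_eq:
  fixes b :: "'n \<Rightarrow> complex^'n" and S :: "complex^'n^'n"
  assumes h: "hermitian_form h" and b: "diagonalizing_basis h b"
    and S: "\<And>u. h (S *v u) (S *v u) = - (complex_of_real c) * h u u" and c: "c > 0"
  shows "card {i. Re (h (b i) (b i)) > 0} = card {i. Re (h (b i) (b i)) < 0}"
proof (rule antisym)
  show "card {i. Re (h (b i) (b i)) > 0} \<le> card {i. Re (h (b i) (b i)) < 0}"
    by (rule anti_isometry_card_le[OF assms])
  have "hermitian_form (\<lambda>u v. - h u v)"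
    unfolding hermitian_form_def
  proof (intro conjI allI)
    show "- h v u = cnj (- h u v)" for u v
      using hermitian_formD(3)[OF h, of v u] by simp
  qed (simp_all add: hermitian_formD(1,2)[OF h])
  moreover have "diagonalizing_basis (\<lambda>u v. - h u v) b"
    using b by (simp add: diagonalizing_basis_def)
  ultimately have neg: "hermitian_form (\<lambda>u v. - h u v)" "diagonalizing_basis (\<lambda>u v. - h u v) b" .
  from anti_isometry_card_le[OF neg _ c, of S]
  show "card {i. Re (h (b i) (b i)) < 0} \<le> card {i. Re (h (b i) (b i)) > 0}"
    by (simp add: S)
qed

lemma mat_mult_vec: "mat c *v u = c *s (u :: complex^'n)"
  by (simp add: vec_eq_iff matrix_vector_mult_def mat_def if_distrib[of "\<lambda>x. x * _"] cong: if_cong)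

section \<open>Division gradings with one-dimensional components\<close>

lemma (in complex_algebra) scale_power: "(smul c x) ^ n = smul (c ^ n) (x ^ n)"
  by (induction n) (simp_all add: smul_mult_left smul_mult_right)

locale graded_division_algebra = comm_group G + complex_algebra smul
  for G :: "('g, 'b) monoid_scheme" (structure)
    and smul :: "complex \<Rightarrow> 'd::ring_1 \<Rightarrow> 'd"
    and D :: "'g \<Rightarrow> 'd set" +
  assumes division_grading: "division_grading G smul D"
    and identity_component: "D \<one> = range (\<lambda>c. smul c 1)"
    and one_nonzero: "(1::'d) \<noteq> 0"
begin

abbreviation "T \<equiv> grading_support G D"

lemma subspace_component: "g \<in> carrier G \<Longrightarrow> subspace (D g)"
  using division_grading by (simp add: division_grading_def grading_def)

lemma mult_in_component:
  "\<lbrakk>g \<in> carrier G; h \<in> carrier G; x \<in> D g; y \<in> D h\<rbrakk> \<Longrightarrow> x * y \<in> D (g \<otimes> h)"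
  using division_grading by (simp add: division_grading_def grading_def)

lemma one_in_component: "1 \<in> D \<one>"
  unfolding identity_component by (metis rangeI scale_one)

lemma power_in_component: "\<lbrakk>g \<in> carrier G; x \<in> D g\<rbrakk> \<Longrightarrow> x ^ n \<in> D (g [^] n)"
proof (induction n)
  case (Suc n)
  then show ?case
    using mult_in_component[of "g [^] n" g] by (metis nat_pow_Suc nat_pow_closed power_Suc2)
qed (simp add: one_in_component)

lemma mult_nonzero:
  assumes "g \<in> carrier G" "x \<in> D g" "x \<noteq> 0" "y \<noteq> 0"
  shows "x * y \<noteq> 0"
proof
  assume "x * y = 0"
  obtain z where "z * x = 1"
    using division_grading assms unfolding division_grading_def by blast
  then have "y = z * (x * y)" by (simp flip: mult.assoc)
  then show False using \<open>x * y = 0\<close> \<open>y \<noteq> 0\<close> by simp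
qed

lemma power_nonzero: "\<lbrakk>g \<in> carrier G; x \<in> D g; x \<noteq> 0\<rbrakk> \<Longrightarrow> x ^ n \<noteq> 0"
  by (induction n) (simp_all add: one_nonzero mult_nonzero)

lemma component_eq_multiples:
  assumes g: "g \<in> carrier G" and x: "x \<in> D g" "x \<noteq> 0"
  shows "D g = range (\<lambda>c. smul c x)"
proof -
  have "dim (D g) = 1"
    using division_grading assms by (auto simp: division_grading_def)
  then obtain B where B: "B \<subseteq> D g" "D g \<subseteq> span B" "card B = 1"
    by (metis basis_exists)
  then obtain b where b: "B = {b}" by (auto simp: card_1_singleton_iff)
  then obtain c where c: "x = smul c b"
    using B x by (auto simp: span_singleton)
  then have "c \<noteq> 0" using x by auto
  then have "b = smul (inverse c) x" using c by simp
  moreover have "D g \<subseteq> span {b}" using B b by simp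
  ultimately have "D g \<subseteq> span {x}"
    by (metis insert_subset span_minimal subset_trans empty_subsetI subspace_span span_base span_scale singletonI)
  moreover have "range (\<lambda>c. smul c x) \<subseteq> D g"
    using subspace_component[OF g] x by (auto intro: subspace_scale)
  ultimately show ?thesis by (auto simp: span_singleton)
qed

text \<open>Both \<open>c\<close>, extended by \<open>0\<close>, and the zero family are homogeneous decompositions of \<open>0\<close>.\<close>

lemma homogeneous_sum_zeroD:
  assumes F: "finite F" "F \<subseteq> carrier G" and c: "\<And>i. i \<in> F \<Longrightarrow> c i \<in> D i"
    and sum: "(\<Sum>i\<in>F. c i) = 0" and i: "i \<in> F"
  shows "c i = 0"
proof -
  have zero: "0 \<in> D g" if "g \<in> carrier G" for g
    using subspace_component[OF that] by (rule subspace_0)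
  define f where "f i = (if i \<in> F then c i else 0)" for i
  define R where "R c \<longleftrightarrow> (\<forall>i\<in>carrier G. c i \<in> D i) \<and> (\<forall>i. i \<notin> carrier G \<longrightarrow> c i = 0) \<and>
      finite {i. c i \<noteq> 0} \<and> 0 = (\<Sum>i | c i \<noteq> 0. c i)" for c :: "'g \<Rightarrow> 'd"
  have "\<exists>!c. R c"
    using division_grading
    unfolding R_def division_grading_def grading_def direct_sum_decomposition_def
    by (elim conjE) (rule spec)
  moreover have "R (\<lambda>_. 0)" using zero by (simp add: R_def)
  moreover have "R f"
  proof -
    have "(\<Sum>i | f i \<noteq> 0. f i) = (\<Sum>i\<in>F. f i)"
      using F by (intro sum.mono_neutral_left) (auto simp: f_def)
    then have "(\<Sum>i | f i \<noteq> 0. f i) = 0"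
      using sum by (simp add: f_def)
    moreover have "finite {i. f i \<noteq> 0}"
      by (rule finite_subset[OF _ F(1)]) (auto simp: f_def)
    ultimately show ?thesis
      using F c zero by (auto simp: R_def f_def)
  qed
  ultimately have "f = (\<lambda>_. 0)" by blast
  then show ?thesis using i by (metis f_def)
qed

lemma homogeneous_family_independent:
  assumes S: "S \<subseteq> carrier G" and X: "\<And>s. s \<in> S \<Longrightarrow> X s \<in> D s" "\<And>s. s \<in> S \<Longrightarrow> X s \<noteq> 0"
  shows "inj_on X S" "independent (X ` S)"
proof -
  have zero: "u i = 0" if "finite F" "F \<subseteq> S" "(\<Sum>i\<in>F. smul (u i) (X i)) = 0" "i \<in> F" for F u i
  proof -
    have "smul (u i) (X i) = 0"
      using that S X by (intro homogeneous_sum_zeroD[of F "\<lambda>i. smul (u i) (X i)"])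
        (auto intro!: subspace_scale[OF subspace_component])
    then show ?thesis using X that by (auto simp: scale_eq_0_iff)
  qed
  show inj: "inj_on X S"
  proof (rule inj_onI, rule ccontr)
    fix s t assume st: "s \<in> S" "t \<in> S" "X s = X t" "s \<noteq> t"
    then have "(\<Sum>i\<in>{s,t}. smul (if i = s then 1 else -1) (X i)) = 0" by simp
    from zero[OF _ _ this, of s] st show False by simp
  qed
  show "independent (X ` S)"
  proof (subst independent_explicit_module, intro allI impI)
    fix t u v assume t: "finite t" "t \<subseteq> X ` S" "(\<Sum>v\<in>t. smul (u v) v) = 0" "v \<in> t"
    then obtain F where F: "finite F" "F \<subseteq> S" "t = X ` F"
      by (meson finite_subset_image)
    then have "inj_on X F" using inj inj_on_subset by blast
    then have "(\<Sum>i\<in>F. smul (u (X i)) (X i)) = 0"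
      using t F by (simp add: sum.reindex)
    from zero[OF F(1,2) this] show "u v = 0" using t F by auto
  qed
qed

lemma homogeneous_family_basis:
  assumes S: "S \<subseteq> carrier G" and X: "\<And>s. s \<in> S \<Longrightarrow> X s \<in> D s" "\<And>s. s \<in> S \<Longrightarrow> X s \<noteq> 0"
  shows "indexed_basis smul (component_sum smul D S) S X"
proof -
  have "span (X ` S) = span (\<Union>s\<in>S. D s)"
  proof (rule antisym)
    show "span (X ` S) \<subseteq> span (\<Union>s\<in>S. D s)"
      using X by (intro span_mono) auto
    have "D s \<subseteq> span (X ` S)" if "s \<in> S" for s
    proof -
      have "D s = range (\<lambda>c. smul c (X s))"
        using X S that by (intro component_eq_multiples) auto
      then show ?thesis using that by (simp add: image_subset_iff span_scale span_base)
    qed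
    then show "span (\<Union>s\<in>S. D s) \<subseteq> span (X ` S)"
      by (intro span_minimal) auto
  qed
  then show ?thesis
    using homogeneous_family_independent[OF assms]
    by (simp add: indexed_basis_def component_sum_def)
qed

lemma support_subset: "T \<subseteq> carrier G"
  by (auto simp: grading_support_def)

lemma supportI: "\<lbrakk>g \<in> carrier G; x \<in> D g; x \<noteq> 0\<rbrakk> \<Longrightarrow> g \<in> T"
  by (auto simp: grading_support_def)

lemma support_nonzero:
  assumes "t \<in> T" obtains x where "x \<in> D t" "x \<noteq> 0"
  using assms subspace_0[OF subspace_component, of t] by (auto simp: grading_support_def)

lemma one_in_support: "\<one> \<in> T"
  using supportI one_in_component one_nonzero by simp

lemma mult_in_support: "\<lbrakk>s \<in> T; t \<in> T\<rbrakk> \<Longrightarrow> s \<otimes> t \<in> T"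
  by (metis m_closed mult_in_component mult_nonzero subsetD supportI support_nonzero support_subset)

lemma power_in_support: "t \<in> T \<Longrightarrow> t [^] (n::nat) \<in> T"
  by (induction n) (simp_all add: one_in_support mult_in_support)

lemma ord_support_pos:
  assumes "finite T" "t \<in> T"
  shows "ord t > 0"
proof (rule ccontr)
  assume "\<not> ord t > 0"
  then have "inj (\<lambda>n::nat. t [^] n)"
    using assms support_subset infinite_cyclic_subgroup[of t] infinite_cyclic_subgroup_order[of t]
    by (auto simp: inj_def)
  then have "infinite (range (\<lambda>n::nat. t [^] n))"
    using range_inj_infinite by blast
  moreover have "range (\<lambda>n::nat. t [^] n) \<subseteq> T"
    using power_in_support[OF assms(2)] by auto
  ultimately show False using assms(1) finite_subset by blast
qed

text \<open>A nonempty finite subset of a group that is closed under products is a subgroup.\<close>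

lemma inverse_in_support:
  assumes "finite T" "t \<in> T" shows "inv t \<in> T"
proof -
  have "t [^] (ord t - 1) \<otimes> t = \<one>"
    using ord_support_pos[OF assms] support_subset assms pow_ord_eq_1[of t]
    by (metis Suc_diff_1 nat_pow_Suc subsetD)
  then have "inv t = t [^] (ord t - 1)"
    using inv_equality support_subset assms by (meson nat_pow_closed subsetD)
  then show ?thesis using power_in_support assms by simp
qed

text \<open>Since \<open>y\<^sup>2\<close> is a scalar, conjugating \<open>x\<close> twice by \<open>y\<close> is trivial; the commutation factor is
  therefore a square root of \<open>1\<close>.\<close>

lemma order_two_commutes_up_to_sign:
  assumes t: "t \<in> carrier G" "x \<in> D t" "x \<noteq> 0"
    and a: "a \<in> carrier G" "a \<otimes> a = \<one>" "y \<in> D a" "y \<noteq> 0"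
  shows "x * y = y * x \<or> x * y = - (y * x)"
proof -
  have "y * x \<in> D (t \<otimes> a)" "x * y \<in> D (t \<otimes> a)" "y * x \<noteq> 0"
    using mult_in_component[of a t y x] mult_in_component[of t a x y] mult_nonzero[of a y x] t a
    by (simp_all add: m_comm)
  then obtain c where c: "x * y = smul c (y * x)"
    using component_eq_multiples[of "t \<otimes> a" "y * x"] t a by auto
  have "y * y \<in> D \<one>" using mult_in_component[of a a y y] a by simp
  then obtain d where d: "y * y = smul d 1" by (auto simp: identity_component)
  have "x * (y * y) = smul c (y * (x * y))"
    by (metis c mult.assoc smul_mult_left)
  also have "\<dots> = smul (c * c) ((y * y) * x)"
    by (simp add: c smul_mult_right mult.assoc)
  finally have "smul d x = smul (c * c) (smul d x)"
    by (simp add: d smul_mult_left smul_mult_right)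
  moreover have "smul d x \<noteq> 0"
    using mult_nonzero[of a y y] a d t by auto
  ultimately have "c * c = 1"
    by (metis scale_one scale_right_imp_eq)
  then have "c = 1 \<or> c = -1" by (simp add: square_eq_1_iff)
  then show ?thesis using c by auto
qed

end

section \<open>Graded involutions of the second kind\<close>

locale graded_involution = graded_division_algebra G smul D
  for G :: "('g, 'b) monoid_scheme" (structure)
    and smul :: "complex \<Rightarrow> 'd::ring_1 \<Rightarrow> 'd"
    and D :: "'g \<Rightarrow> 'd set" +
  fixes \<phi> :: "'d \<Rightarrow> 'd"
  assumes second_kind: "second_kind_involution smul \<phi>"
    and component_image: "g \<in> carrier G \<Longrightarrow> \<phi> ` D g = D g"
begin

lemma involution_add: "\<phi> (x + y) = \<phi> x + \<phi> y"
  and involution_mult: "\<phi> (x * y) = \<phi> y * \<phi> x"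
  and involution_involution: "\<phi> (\<phi> x) = x"
  and involution_real: "\<phi> (smul (complex_of_real r) x) = smul (complex_of_real r) (\<phi> x)"
  and involution_i: "\<phi> (smul \<i> 1) = - smul \<i> 1"
  using second_kind by (auto simp: second_kind_involution_def involution_def)

lemma involution_scale: "\<phi> (smul c x) = smul (cnj c) (\<phi> x)"
proof -
  have i: "\<phi> (smul \<i> y) = - smul \<i> (\<phi> y)" for y
    using involution_mult[of "smul \<i> 1" y] by (simp add: smul_mult_left smul_mult_right involution_i)
  have "\<phi> (smul c x) = \<phi> (smul (of_real (Re c)) x + smul (of_real (Im c)) (smul \<i> x))"
    by (simp add: mult.commute flip: scale_left_distrib complex_eq)
  also have "\<dots> = smul (of_real (Re c)) (\<phi> x) - smul (of_real (Im c)) (smul \<i> (\<phi> x))"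
    by (simp only: involution_add involution_real i scale_minus_right diff_conv_add_uminus)
  also have "\<dots> = smul (of_real (Re c) - of_real (Im c) * \<i>) (\<phi> x)"
    by (simp add: scale_left_diff_distrib)
  also have "of_real (Re c) - of_real (Im c) * \<i> = cnj c"
    by (simp add: complex_eq_iff)
  finally show ?thesis .
qed

lemma involution_one: "\<phi> 1 = 1"
  by (metis involution_involution involution_mult mult.left_neutral mult.right_neutral)

lemma involution_power: "\<phi> x = x \<Longrightarrow> \<phi> (x ^ n) = x ^ n"
  by (induction n) (simp_all add: involution_one involution_mult power_commutes)

text \<open>If symmetrising a nonzero \<open>b \<in> D t\<close> gives \<open>b + \<phi> b = 0\<close>, then \<open>b\<close> is skew, and conjugate-linearity
  of \<open>\<phi>\<close> makes \<open>\<i> * b\<close> symmetric.\<close>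

lemma symmetric_exists:
  assumes "t \<in> T"
  obtains x where "x \<in> D t" "x \<noteq> 0" "\<phi> x = x"
proof -
  have t: "t \<in> carrier G" using assms support_subset by auto
  obtain b where b: "b \<in> D t" "b \<noteq> 0" using support_nonzero[OF assms] .
  have "\<phi> b \<in> D t" using component_image[OF t] b by auto
  show ?thesis
  proof (cases "b + \<phi> b = 0")
    case False
    have "b + \<phi> b \<in> D t"
      using subspace_add[OF subspace_component[OF t]] b \<open>\<phi> b \<in> D t\<close> by blast
    with False show ?thesis
      by (intro that[of "b + \<phi> b"]) (simp_all add: involution_add involution_involution add.commute)
  next
    case True
    then have "\<phi> b = - b" by (simp add: eq_neg_iff_add_eq_0 add.commute)
    then have "\<phi> (smul \<i> b) = smul \<i> b" by (simp add: involution_scale)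
    moreover have "smul \<i> b \<in> D t"
      using subspace_scale[OF subspace_component[OF t]] b by blast
    ultimately show ?thesis using b by (intro that[of "smul \<i> b"]) (simp_all add: scale_eq_0_iff)
  qed
qed

lemma symmetric_real_multiple:
  assumes "t \<in> carrier G" and x: "x \<in> D t" "x \<noteq> 0" "\<phi> x = x" and y: "y \<in> D t" "y \<noteq> 0" "\<phi> y = y"
  obtains r where "r \<noteq> 0" "y = smul (complex_of_real r) x"
proof -
  obtain c where c: "y = smul c x"
    using component_eq_multiples[of t x] assms by auto
  then have "smul (cnj c) x = smul c x"
    using x y by (metis involution_scale)
  then have "cnj c = c" using x by (metis scale_right_imp_eq)
  then obtain r where r: "c = complex_of_real r" by (metis Reals_cases Reals_cnj_iff)
  show ?thesis using that[of r] c r y by auto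
qed

lemma symmetric_scalar:
  assumes "x \<in> D \<one>" "x \<noteq> 0" "\<phi> x = x"
  obtains r where "r \<noteq> 0" "x = smul (complex_of_real r) 1"
  using symmetric_real_multiple[of \<one> 1 x] assms one_in_component one_nonzero involution_one by auto

text \<open>If \<open>x ^ ord t\<close> were a negative real for \<open>t\<close> of order \<open>2 * m\<close>, the selfadjoint operator \<open>x ^ m\<close>
  would have a negative scalar square and hence be an anti-isometry up to a positive factor.\<close>

lemma nonzero_signature_imp_positive_power:
  assumes iso: "matrix_algebra_iso smul \<Psi>" and sig: "has_signature \<Psi> \<phi> k" "k \<noteq> 0"
    and t: "t \<in> T" "even (ord t)" and x: "x \<in> D t" "x \<noteq> 0" "\<phi> x = x"
  shows "x ^ ord t \<in> positive_multiples smul 1"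
proof -
  have tc: "t \<in> carrier G" using t support_subset by auto
  have "x ^ ord t \<in> D \<one>" using power_in_component[OF tc x(1), of "ord t"] tc by simp
  then obtain r where r: "r \<noteq> 0" "x ^ ord t = smul (complex_of_real r) 1"
    using symmetric_scalar power_nonzero[OF tc x(1,2)] involution_power[OF x(3)] by blast
  have "\<not> r < 0"
  proof
    assume "r < 0"
    obtain m where m: "ord t = m + m" using t(2) by (metis evenE mult_2)
    obtain h b where h: "hermitian_form h" "adjoint_to \<Psi> \<phi> h" "diagonalizing_basis h b"
      and k: "k = nat \<bar>int (card {i. Re (h (b i) (b i)) > 0}) - int (card {i. Re (h (b i) (b i)) < 0})\<bar>"
      using sig(1) by (auto simp: has_signature_def)
    let ?S = "\<Psi> (x ^ m)"
    have "h (?S *v u) (?S *v u) = - complex_of_real (- r) * h u u" for u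
    proof -
      have "h (?S *v u) (?S *v u) = h u (?S *v (?S *v u))"
        using h(2) involution_power[OF x(3)] by (simp add: adjoint_to_def)
      also have "?S *v (?S *v u) = \<Psi> (x ^ ord t) *v u"
        using iso by (simp add: m power_add matrix_algebra_iso_def matrix_vector_mul_assoc)
      also have "\<dots> = complex_of_real r *s u"
        using iso by (simp add: r matrix_algebra_iso_def mat_mult_vec)
      also have "h u \<dots> = complex_of_real r * h u u"
        by (rule hermitian_formD(2)[OF h(1)])
      finally show ?thesis by simp
    qed
    from anti_isometry_card_eq[OF h(1,3) this] \<open>r < 0\<close> have "k = 0" using k by simp
    then show False using sig(2) by simp
  qed
  then show ?thesis using r by (auto simp: positive_multiples_def)
qed

end

section \<open>Squares of symmetric elements\<close>

text \<open>Of the equivalent descriptions of a distinguished involution, the one by positivity of powers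
  is the one that mentions neither a form nor an isomorphism with a matrix algebra.\<close>

locale distinguished_graded_involution = graded_involution G smul D \<phi>
  for G :: "('g, 'b) monoid_scheme" (structure)
    and smul :: "complex \<Rightarrow> 'd::ring_1 \<Rightarrow> 'd"
    and D :: "'g \<Rightarrow> 'd set"
    and \<phi> :: "'d \<Rightarrow> 'd" +
  assumes finite_support: "finite T"
    and positive_power: "\<lbrakk>t \<in> T; even (ord t); x \<in> D t; x \<noteq> 0; \<phi> x = x\<rbrakk>
      \<Longrightarrow> x ^ ord t \<in> positive_multiples smul 1"
begin

lemma positive_square_of_order_two:
  assumes a: "a \<in> T" "a \<otimes> a = \<one>" and y: "y \<in> D a" "y \<noteq> 0" "\<phi> y = y"
  shows "y\<^sup>2 \<in> positive_multiples smul 1"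
proof (cases "a = \<one>")
  case True
  then obtain r where "r \<noteq> 0" "y = smul (complex_of_real r) 1"
    using symmetric_scalar y by blast
  then have "y\<^sup>2 = smul (complex_of_real (r\<^sup>2)) 1" "r\<^sup>2 > 0"
    by (simp_all add: scale_power)
  then show ?thesis unfolding positive_multiples_def by blast
next
  case False
  have ac: "a \<in> carrier G" using a support_subset by auto
  have "a [^] (2::nat) = \<one>" using a ac by (simp add: numeral_2_eq_2)
  then have "ord a dvd 2" using ac by (simp add: pow_eq_id)
  moreover have "ord a \<noteq> 1" using False ac ord_eq_1[of a] by blast
  ultimately have "ord a = 2" by (metis prime_nat_iff two_is_prime_nat)
  then show ?thesis using positive_power[OF a(1) _ y] by simp
qed

text \<open>With \<open>t' = t \<otimes> a\<close> and symmetric \<open>y \<in> D a\<close>, the element \<open>z\<close> is the symmetric one among \<open>x * y\<close> and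
  \<open>\<i> * x * y\<close>: in the anticommuting case, the sign from reordering \<open>(x * y) * (x * y)\<close> cancels \<open>\<i>\<^sup>2\<close>.\<close>

lemma square_unique_up_to_positive:
  assumes t: "t \<in> T" and x: "x \<in> D t" "x \<noteq> 0" "\<phi> x = x"
    and t': "t' \<in> T" and x': "x' \<in> D t'" "x' \<noteq> 0" "\<phi> x' = x'" and eq: "t' \<otimes> t' = t \<otimes> t"
  shows "x'\<^sup>2 \<in> positive_multiples smul (x\<^sup>2)"
proof -
  have tc: "t \<in> carrier G" "t' \<in> carrier G" using t t' support_subset by auto
  define a where "a = inv t \<otimes> t'"
  have a: "a \<in> T" unfolding a_def using mult_in_support inverse_in_support[OF finite_support] t t' by auto
  then have ac: "a \<in> carrier G" using support_subset by auto
  have ta: "t \<otimes> a = t'" using tc by (simp add: a_def flip: m_assoc)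
  have "a \<otimes> a = inv (t \<otimes> t) \<otimes> (t' \<otimes> t')"
    using tc by (simp add: a_def inv_mult m_ac)
  then have aa: "a \<otimes> a = \<one>" using tc by (simp add: eq)
  obtain y where y: "y \<in> D a" "y \<noteq> 0" "\<phi> y = y" using symmetric_exists[OF a] .
  obtain p where p: "p > 0" "y * y = smul (complex_of_real p) 1"
    using positive_square_of_order_two[OF a aa y] by (auto simp: positive_multiples_def power2_eq_square)
  have xy: "x * y \<in> D t'" "x * y \<noteq> 0"
    using mult_in_component[of t a x y] mult_nonzero[of t x y] tc ac x y ta by simp_all
  have xxyy: "x * x * (y * y) = smul (complex_of_real p) (x\<^sup>2)"
    by (simp add: p smul_mult_right power2_eq_square)
  have "\<exists>z. z \<in> D t' \<and> z \<noteq> 0 \<and> \<phi> z = z \<and> z * z = smul (complex_of_real p) (x\<^sup>2)"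
    using order_two_commutes_up_to_sign[OF tc(1) x(1,2) ac aa y(1,2)]
  proof
    assume comm: "x * y = y * x"
    have "(x * y) * (x * y) = x * x * (y * y)"
      by (metis comm mult.assoc)
    then show ?thesis
      using xy x y xxyy comm by (intro exI[of _ "x * y"]) (simp add: involution_mult)
  next
    assume anti: "x * y = - (y * x)"
    have "(x * y) * (x * y) = x * (y * x) * y" by (simp add: mult.assoc)
    also have "y * x = - (x * y)" by (simp add: anti)
    finally have "(x * y) * (x * y) = - (x * x * (y * y))" by (simp add: mult.assoc)
    then have "smul \<i> (x * y) * smul \<i> (x * y) = x * x * (y * y)"
      by (simp add: smul_mult_left smul_mult_right)
    moreover have "\<phi> (smul \<i> (x * y)) = smul \<i> (- (y * x))"
      by (simp add: involution_scale involution_mult x y)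
    then have "\<phi> (smul \<i> (x * y)) = smul \<i> (x * y)"
      by (simp only: anti)
    moreover have "smul \<i> (x * y) \<in> D t'"
      using subspace_scale[OF subspace_component[OF tc(2)]] xy by blast
    ultimately show ?thesis
      using xy xxyy by (intro exI[of _ "smul \<i> (x * y)"]) (simp add: scale_eq_0_iff)
  qed
  then obtain z where z: "z \<in> D t'" "z \<noteq> 0" "\<phi> z = z" "z * z = smul (complex_of_real p) (x\<^sup>2)"
    by blast
  obtain r where r: "r \<noteq> 0" "x' = smul (complex_of_real r) z"
    using symmetric_real_multiple[OF tc(2) z(1-3) x'] .
  have "z\<^sup>2 = smul (complex_of_real p) (x\<^sup>2)"
    by (simp only: power2_eq_square[of z] z(4))
  then have "x'\<^sup>2 = smul (complex_of_real (r\<^sup>2 * p)) (x\<^sup>2)"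
    by (simp add: r scale_power)
  moreover have "r\<^sup>2 * p > 0" using r p by simp
  ultimately show ?thesis unfolding positive_multiples_def by blast
qed

lemma square_positive_power:
  assumes t: "t \<in> T" and x: "x \<in> D t" "x \<noteq> 0" "\<phi> x = x"
  shows "(x\<^sup>2) ^ ord (t \<otimes> t) \<in> positive_multiples smul 1"
proof -
  have tc: "t \<in> carrier G" using t support_subset by auto
  have "t \<otimes> t = t [^] (2::nat)" using tc by (simp add: numeral_2_eq_2)
  then have ord: "ord (t \<otimes> t) = ord t div gcd (ord t) 2" using tc by (simp add: ord_pow_gen)
  show ?thesis
  proof (cases "even (ord t)")
    case True
    then have "gcd (ord t) 2 = 2" by (simp add: gcd_proj2_iff)
    then have "(x\<^sup>2) ^ ord (t \<otimes> t) = x ^ ord t"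
      using True by (simp add: ord flip: power_mult)
    then show ?thesis using positive_power[OF t True x] by simp
  next
    case False
    then have "gcd (ord t) 2 = 1" by (simp add: coprime_iff_gcd_eq_1[symmetric])
    then have "(x\<^sup>2) ^ ord (t \<otimes> t) = (x ^ ord t)\<^sup>2"
      by (simp add: ord mult.commute flip: power_mult)
    moreover have "x ^ ord t \<in> D \<one>" using power_in_component[OF tc x(1), of "ord t"] tc by simp
    then obtain r where "r \<noteq> 0" "x ^ ord t = smul (complex_of_real r) 1"
      using symmetric_scalar power_nonzero[OF tc x(1,2)] involution_power[OF x(3)] by blast
    ultimately have "(x\<^sup>2) ^ ord (t \<otimes> t) = smul (complex_of_real (r\<^sup>2)) 1" "r\<^sup>2 > 0"
      by (simp_all add: scale_power)
    then show ?thesis unfolding positive_multiples_def by blast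
  qed
qed

definition normalized_square :: "'g \<Rightarrow> 'd \<Rightarrow> bool" where
  "normalized_square s z \<longleftrightarrow> z \<in> D s \<and> \<phi> z = z \<and> z ^ ord s = 1 \<and>
     (\<forall>t\<in>T. t \<otimes> t = s \<longrightarrow> (\<forall>x\<in>D t. x \<noteq> 0 \<longrightarrow> \<phi> x = x \<longrightarrow> x ^ 2 \<in> positive_multiples smul z))"

lemma normalized_square_exists:
  assumes "t \<in> T"
  shows "\<exists>z. normalized_square (t \<otimes> t) z"
proof -
  have tc: "t \<in> carrier G" using assms support_subset by auto
  have n: "ord (t \<otimes> t) > 0"
    using ord_support_pos[OF finite_support] mult_in_support assms by simp
  obtain x where x: "x \<in> D t" "x \<noteq> 0" "\<phi> x = x" using symmetric_exists[OF assms] .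
  obtain p where p: "p > 0" "(x\<^sup>2) ^ ord (t \<otimes> t) = smul (complex_of_real p) 1"
    using square_positive_power[OF assms x] by (auto simp: positive_multiples_def)
  define r where "r = root (ord (t \<otimes> t)) (1 / p)"
  have r: "r > 0" "r ^ ord (t \<otimes> t) = 1 / p"
    using p n by (simp_all add: r_def real_root_gt_zero real_root_pow_pos)
  define z where "z = smul (complex_of_real r) (x\<^sup>2)"
  have "x\<^sup>2 \<in> D (t \<otimes> t)"
    using mult_in_component[OF tc tc x(1) x(1)] by (simp add: power2_eq_square)
  then have "z \<in> D (t \<otimes> t)"
    unfolding z_def using subspace_scale[OF subspace_component] tc by simp
  moreover have "\<phi> z = z"
    by (simp add: z_def involution_scale involution_power x)
  moreover have "z ^ ord (t \<otimes> t) = 1"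
    using p by (simp add: z_def scale_power r flip: of_real_power)
  moreover have "x'\<^sup>2 \<in> positive_multiples smul z"
    if x': "t' \<in> T" "t' \<otimes> t' = t \<otimes> t" "x' \<in> D t'" "x' \<noteq> 0" "\<phi> x' = x'" for t' x'
  proof -
    obtain q where q: "q > 0" "x'\<^sup>2 = smul (complex_of_real q) (x\<^sup>2)"
      using square_unique_up_to_positive[OF assms x x'(1,3,4,5,2)] by (auto simp: positive_multiples_def)
    then have "x'\<^sup>2 = smul (complex_of_real (q / r)) z" "q / r > 0"
      using r by (simp_all add: z_def)
    then show ?thesis unfolding positive_multiples_def by blast
  qed
  ultimately show ?thesis unfolding normalized_square_def by blast
qed

lemma normalized_square_unique:
  assumes t: "t \<in> T" and z: "normalized_square (t \<otimes> t) z" "normalized_square (t \<otimes> t) z'"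
  shows "z' = z"
proof -
  have n: "ord (t \<otimes> t) > 0"
    using ord_support_pos[OF finite_support] mult_in_support t by simp
  obtain x where x: "x \<in> D t" "x \<noteq> 0" "\<phi> x = x" using symmetric_exists[OF t] .
  obtain p q where pq: "p > 0" "x\<^sup>2 = smul (complex_of_real p) z" "q > 0" "x\<^sup>2 = smul (complex_of_real q) z'"
    using z t x unfolding normalized_square_def positive_multiples_def by blast
  define r where "r = p / q"
  have "r > 0" using pq by (simp add: r_def)
  have "z' = smul (complex_of_real (inverse q)) (smul (complex_of_real q) z')"
    using pq(3) by simp
  also have "\<dots> = smul (complex_of_real (inverse q)) (smul (complex_of_real p) z)"
    by (metis pq(2,4))
  also have "\<dots> = smul (complex_of_real r) z"
    by (simp add: r_def divide_inverse mult.commute)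
  finally have z': "z' = smul (complex_of_real r) z" .
  then have "smul (complex_of_real (r ^ ord (t \<otimes> t))) 1 = smul 1 1"
    using z by (simp add: normalized_square_def scale_power)
  then have "complex_of_real (r ^ ord (t \<otimes> t)) = 1"
    using one_nonzero by (metis scale_right_imp_eq)
  then have "r ^ ord (t \<otimes> t) = 1" by (metis of_real_eq_1_iff)
  then have "r = 1" using n \<open>r > 0\<close> power_eq_imp_eq_base[of r "ord (t \<otimes> t)" 1] by simp
  then show ?thesis using z' by simp
qed

lemma normalized_square_nonzero:
  assumes "t \<in> T" "normalized_square (t \<otimes> t) z"
  shows "z \<noteq> 0"
  using assms ord_support_pos[OF finite_support mult_in_support, of t t] one_nonzero
  by (auto simp: normalized_square_def power_0_left)

theorem unique_basis_of_squares:
  "\<exists>!X. X \<in> (\<Pi>\<^sub>E s\<in>squares G T. D s) \<and>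
     indexed_basis smul (component_sum smul D (squares G T)) (squares G T) X \<and>
     (\<forall>s\<in>squares G T. \<phi> (X s) = X s \<and> X s ^ ord s = 1 \<and>
        (\<forall>t\<in>T. t \<otimes> t = s \<longrightarrow>
           (\<forall>x\<in>D t. x \<noteq> 0 \<longrightarrow> \<phi> x = x \<longrightarrow> x ^ 2 \<in> positive_multiples smul (X s))))"
  (is "\<exists>!X. ?E X \<and> ?B X \<and> ?N X")
proof -
  have ex: "\<exists>!z. normalized_square s z" if "s \<in> squares G T" for s
    using that normalized_square_exists normalized_square_unique by (auto simp: squares_def)
  have split: "?E X \<and> ?N X \<longleftrightarrow> X \<in> extensional (squares G T) \<and> (\<forall>s\<in>squares G T. normalized_square s (X s))" for X
    unfolding normalized_square_def PiE_def Pi_def by auto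
  have basis: "?B X" if "\<forall>s\<in>squares G T. normalized_square s (X s)" for X
  proof (rule homogeneous_family_basis)
    show "squares G T \<subseteq> carrier G"
      using support_subset by (auto simp: squares_def)
    fix s assume "s \<in> squares G T"
    then show "X s \<in> D s" "X s \<noteq> 0"
      using that normalized_square_nonzero by (auto simp: squares_def normalized_square_def)
  qed
  define X where "X = restrict (\<lambda>s. THE z. normalized_square s z) (squares G T)"
  have X: "normalized_square s (X s)" if "s \<in> squares G T" for s
    unfolding X_def using that theI'[OF ex[OF that]] by simp
  show ?thesis
  proof (rule ex1I[of _ X])
    show "?E X \<and> ?B X \<and> ?N X"
      using split[of X] basis[of X] X by (simp add: X_def)
    fix Y assume "?E Y \<and> ?B Y \<and> ?N Y"
    then have "Y \<in> extensional (squares G T)" "\<forall>s\<in>squares G T. normalized_square s (Y s)"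
      using split[of Y] by blast+
    then show "Y = X"
    proof (intro extensionalityI[of Y "squares G T" X])
      show "Y s = X s" if "s \<in> squares G T" for s
        using ex[OF that] X[OF that] that \<open>\<forall>s\<in>squares G T. normalized_square s (Y s)\<close> by blast
    qed (simp_all add: X_def)
  qed
qed

end

section \<open>Gradings on matrix algebras\<close>

lemma mat_mult_matrix: "mat c ** A = (\<chi> i j. c * (A :: complex^'n^'n) $ i $ j)"
  by (simp add: vec_eq_iff matrix_matrix_mult_def mat_def if_distrib[of "\<lambda>x. x * _"] cong: if_cong)

text \<open>Seen as a real linear map, \<open>\<Psi>\<close> turns \<open>B\<close> into a linearly independent subset of a Euclidean
  space.\<close>

lemma (in complex_algebra) independent_finite_of_matrix_algebra:
  assumes iso: "matrix_algebra_iso smul (\<Psi> :: 'd \<Rightarrow> complex^'n^'n)" and B: "independent B"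
  shows "finite B"
proof -
  have inj: "inj \<Psi>" and add: "\<And>x y. \<Psi> (x + y) = \<Psi> x + \<Psi> y"
    and scale: "\<And>c x. \<Psi> (smul c x) = mat c ** \<Psi> x"
    using iso by (auto simp: matrix_algebra_iso_def bij_def)
  interpret additive \<Psi> by unfold_locales (rule add)
  have real: "\<Psi> (smul (complex_of_real r) x) = r *\<^sub>R \<Psi> x" for r x
    by (simp add: scale mat_mult_matrix vec_eq_iff) (simp add: scaleR_conv_of_real)
  have "\<not> real_vector.dependent (\<Psi> ` B)"
  proof (subst real_vector.independent_explicit_module, intro allI impI)
    fix S u v assume S: "finite S" "S \<subseteq> \<Psi> ` B" "(\<Sum>v\<in>S. u v *\<^sub>R v) = 0" "v \<in> S"
    then obtain F where F: "finite F" "F \<subseteq> B" "S = \<Psi> ` F"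
      by (meson finite_subset_image)
    have "\<Psi> (\<Sum>x\<in>F. smul (complex_of_real (u (\<Psi> x))) x) = (\<Sum>x\<in>F. u (\<Psi> x) *\<^sub>R \<Psi> x)"
      by (simp add: sum real)
    also have "\<dots> = \<Psi> 0"
      using S(3) inj_on_subset[OF inj, of F] by (simp add: F sum.reindex zero)
    finally have "(\<Sum>x\<in>F. smul (complex_of_real (u (\<Psi> x))) x) = 0"
      using inj by (metis injD)
    from independentD[OF B F(1,2) this] show "u v = 0" using S(4) F by auto
  qed
  then have "finite (\<Psi> ` B)" by (rule independent_imp_finite)
  then show ?thesis using finite_imageD inj_on_subset[OF inj] by blast
qed

theorem mainTheorem8:
  fixes G :: "('g, 'b) monoid_scheme"
    and smul :: "complex \<Rightarrow> 'd::ring_1 \<Rightarrow> 'd"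
    and \<Psi> :: "'d \<Rightarrow> complex^'n^'n"
    and D :: "'g \<Rightarrow> 'd set"
    and \<phi> :: "'d \<Rightarrow> 'd"
  defines "T \<equiv> grading_support G D"
  assumes "comm_group G"
    and "complex_algebra smul"
    and "matrix_algebra_iso smul \<Psi>"
    and "division_grading G smul D"
    and "D \<one>\<^bsub>G\<^esub> = center"
    and "center = range (\<lambda>c. smul c (1::'d))"
    and "distinguished_involution G smul \<Psi> D \<phi>"
  shows "\<exists>!X. X \<in> (\<Pi>\<^sub>E s\<in>squares G T. D s) \<and>
           indexed_basis smul (component_sum smul D (squares G T)) (squares G T) X \<and>
           (\<forall>s\<in>squares G T.
              \<phi> (X s) = X s \<and>
              X s ^ group.ord G s = 1 \<and>
              (\<forall>t\<in>T. t \<otimes>\<^bsub>G\<^esub> t = s \<longrightarrow>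
                 (\<forall>x\<in>D t. x \<noteq> 0 \<longrightarrow> \<phi> x = x \<longrightarrow> x ^ 2 \<in> positive_multiples smul (X s))))"
proof -
  interpret comm_group G by fact
  interpret complex_algebra smul by fact
  have iso: "matrix_algebra_iso smul \<Psi>" by fact
  have "\<Psi> (0 + 0) = \<Psi> 0 + \<Psi> 0"
    using iso unfolding matrix_algebra_iso_def by blast
  then have "\<Psi> 0 = 0" by simp
  moreover have "\<Psi> 1 \<noteq> 0"
    using iso by (simp add: matrix_algebra_iso_def vec_eq_iff mat_def)
  ultimately have "(1::'d) \<noteq> 0" by metis
  then interpret graded_division_algebra G smul D
    using assms by unfold_locales simp_all
  interpret graded_involution G smul D \<phi>
    using \<open>distinguished_involution G smul \<Psi> D \<phi>\<close>
    by unfold_locales (simp_all add: distinguished_involution_def)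
  have finite: "finite (grading_support G D)"
  proof -
    define X where "X t = (SOME x. x \<in> D t \<and> x \<noteq> 0)" for t
    have X: "X t \<in> D t \<and> X t \<noteq> 0" if "t \<in> grading_support G D" for t
      unfolding X_def using support_nonzero[OF that] by (rule someI_ex) blast
    have "inj_on X (grading_support G D)" "independent (X ` grading_support G D)"
      using homogeneous_family_independent[OF support_subset] X by blast+
    then show ?thesis
      using independent_finite_of_matrix_algebra[OF iso] finite_imageD by blast
  qed
  have "distinguished_graded_involution G smul D \<phi>"
  proof (unfold_locales, rule finite)
    fix t x assume t: "t \<in> grading_support G D" "even (ord t)" and x: "x \<in> D t" "x \<noteq> 0" "\<phi> x = x"
    \<comment> \<open>The value of the signature in the second description is nonzero since \<open>\<one>\<close> belongs to \<open>?T2\<close>,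
      and \<open>?T2\<close> is finite: the cardinality of an infinite set would be \<open>0\<close>.\<close>
    let ?T2 = "{t \<in> grading_support G D. t \<otimes>\<^bsub>G\<^esub> t = \<one>\<^bsub>G\<^esub>}"
    have "\<one>\<^bsub>G\<^esub> \<in> ?T2" using one_in_support by simp
    then have "card ?T2 > 0" using finite by (auto simp: card_gt_0_iff)
    have "k \<noteq> 0" if "real k = sqrt (real (card ?T2))" for k
    proof
      assume "k = 0"
      then have "sqrt (real (card ?T2)) = 0" using that by simp
      then show False using \<open>card ?T2 > 0\<close> by simp
    qed
    then have "(\<exists>k. has_signature \<Psi> \<phi> k \<and> k \<noteq> 0) \<or>
      (\<forall>t\<in>grading_support G D. even (ord t) \<longrightarrow>
           (\<forall>x\<in>D t. x \<noteq> 0 \<longrightarrow> \<phi> x = x \<longrightarrow> x ^ ord t \<in> positive_multiples smul 1))"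
      using \<open>distinguished_involution G smul \<Psi> D \<phi>\<close> unfolding distinguished_involution_def by blast
    then show "x ^ ord t \<in> positive_multiples smul 1"
      using nonzero_signature_imp_positive_power[OF iso _ _ t x] t x by blast
  qed
  then show ?thesis
    unfolding T_def by (rule distinguished_graded_involution.unique_basis_of_squares)
qed

end
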